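(* The Lagrangians $$L^{ij}=(u_i-u)^2-(u_j-u)^2-p^{ij}(u_i-u_j)^2$$ assigned to the oriented plaquettes of $\mathbb Z^N$ ($N\ge3$), with parameters $p^{ij}=-p^{ji}$, are consistent if and only if the parameters $p^{ij}$ evolve according to the star-triangle relation $$p^{ij}_k=-\frac{p^{ij}}{p^{ij}p^{jk}+p^{jk}p^{ki}+p^{ki}p^{ij}}$$ for every elementary cube and all permutations $(i,j,k)$ of its three directions.
   Context: Notation on the lattice: $n\in\mathbb Z^N$, $e_i$ is the $i$-th coordinate vector, $T_i:n\mapsto n+e_i$. Subscripts denote shifts: $u=u(n)$, $u_i=u(n+e_i)$, $u_{ij}=u(n+e_i+e_j)$, etc. The parameter $p^{ij}$ is attached to the plaquette $\sigma^{ij}(n)=(n,n+e_i,n+e_i+e_j,n+e_j)$ and depends on the plaquette; $p^{ij}_k=T_kp^{ij}$ is attached to $\sigma^{ij}(n+e_k)$. Consistency. For an elementary cube with base point $n$ and distinct directions $i,j,k$, put $$S^{ijk}=(T_k-I)L^{ij}+(T_i-I)L^{jk}+(T_j-I)L^{ki}.$$ For the present Lagrangians $S^{ijk}$ does not depend on $u$ and $u_{ijk}$, so the system of corner equations consists of the six linear equations $\partial S^{ijk}/\partial w=0$, $w\in\{u_i,u_j,u_k,u_{ij},u_{jk},u_{ik}\}$. The Lagrangians are called consistent if for every elementary cube this system has the minimal possible rank $2$, i.e. exactly two of the equations are linearly independent (so four fields, e.g. $u_i,u_j,u_k,u_{ij}$, can be prescribed arbitrarily, two corner equations determine the remaining two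 fields, and the remaining four corner equations are then fulfilled automatically). *)

theory Defs
  imports "HOL-Analysis.Analysis" "HOL-Library.Function_Algebras"
begin

abbreviation shift :: "'n::finite \<Rightarrow> int ^ 'n \<Rightarrow> int ^ 'n" where
  "shift i n \<equiv> n + axis i 1"

definition Lagr ::
  "('n::finite \<Rightarrow> 'n \<Rightarrow> int ^ 'n \<Rightarrow> 'a::real_normed_field) \<Rightarrow> 'n \<Rightarrow> 'n \<Rightarrow> (int ^ 'n \<Rightarrow> 'a) \<Rightarrow> int ^ 'n \<Rightarrow> 'a" where
  "Lagr p i j u n =
     (u (shift i n) - u n)\<^sup>2 - (u (shift j n) - u n)\<^sup>2
       - p i j n * (u (shift i n) - u (shift j n))\<^sup>2"

definition cube_sum ::
  "('n::finite \<Rightarrow> 'n \<Rightarrow> int ^ 'n \<Rightarrow> 'a::real_normed_field) \<Rightarrow> 'n \<Rightarrow> 'n \<Rightarrow> 'n \<Rightarrow> (int ^ 'n \<Rightarrow> 'a) \<Rightarrow> int ^ 'n \<Rightarrow> 'a" where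
  "cube_sum p i j k u n =
     (Lagr p i j u (shift k n) - Lagr p i j u n)
   + (Lagr p j k u (shift i n) - Lagr p j k u n)
   + (Lagr p k i u (shift j n) - Lagr p k i u n)"

text \<open>The partial derivative of \<open>cube_sum\<close> with respect to the value of the field at the
  lattice point \<open>v\<close>, as a function of the field.\<close>

definition corner_form ::
  "('n::finite \<Rightarrow> 'n \<Rightarrow> int ^ 'n \<Rightarrow> 'a::real_normed_field) \<Rightarrow> 'n \<Rightarrow> 'n \<Rightarrow> 'n \<Rightarrow> int ^ 'n \<Rightarrow> int ^ 'n
     \<Rightarrow> (int ^ 'n \<Rightarrow> 'a) \<Rightarrow> 'a" where
  "corner_form p i j k n v u = deriv (\<lambda>x. cube_sum p i j k (u(v := x)) n) (u v)"

definition corners :: "'n::finite \<Rightarrow> 'n \<Rightarrow> 'n \<Rightarrow> int ^ 'n \<Rightarrow> (int ^ 'n) set" where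
  "corners i j k n =
     {shift i n, shift j n, shift k n,
      shift j (shift i n), shift k (shift j n), shift k (shift i n)}"

text \<open>The rank of a homogeneous linear system \<open>f = 0\<close>, \<open>f \<in> F\<close>, is the dimension of the
  span of its left-hand sides \<open>f\<close> in the space of scalar functions of the unknowns.\<close>

lemma vector_space_pointwise:
  "vector_space (\<lambda>(c::'a::field) (f::'b \<Rightarrow> 'a) x. c * f x)"
  by unfold_locales (auto simp: fun_eq_iff algebra_simps)

definition system_rank :: "('b \<Rightarrow> 'a::field) set \<Rightarrow> nat" where
  "system_rank F = vector_space.dim (\<lambda>c f x. c * f x) F"

definition consistent ::
  "('n::finite \<Rightarrow> 'n \<Rightarrow> int ^ 'n \<Rightarrow> 'a::real_normed_field) \<Rightarrow> bool" where
  "consistent p \<longleftrightarrow>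
     (\<forall>n i j k. distinct [i, j, k] \<longrightarrow> system_rank (corner_form p i j k n ` corners i j k n) = 2)"

text \<open>Division is total here, so the relation has to state that its right-hand side is
  well defined.\<close>

definition star_triangle ::
  "('n::finite \<Rightarrow> 'n \<Rightarrow> int ^ 'n \<Rightarrow> 'a::real_normed_field) \<Rightarrow> bool" where
  "star_triangle p \<longleftrightarrow>
     (\<forall>n i j k. distinct [i, j, k] \<longrightarrow>
        p i j n * p j k n + p j k n * p k i n + p k i n * p i j n \<noteq> 0 \<and>
        p i j (shift k n) =
          - (p i j n / (p i j n * p j k n + p j k n * p k i n + p k i n * p i j n)))"

end

theory Submission imports Defs begin

text \<open>Let \<open>x, y, z\<close> be the fields at the corners \<open>i, j, k\<close> and \<open>X, Y, Z\<close> those at the corners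
  \<open>jk, ik, ij\<close>. In the sum over the cube all squares of the fields cancel outside the terms with
  parameters. The halved corner forms \<open>d\<^sub>x, d\<^sub>y, d\<^sub>z\<close> add up to zero, and
  \<open>d\<^sub>x = Y - Z + \<dots>\<close>, \<open>d\<^sub>y = Z - X + \<dots>\<close> are independent, so the rank is 2 iff
  \<open>d\<^sub>X, d\<^sub>Y, d\<^sub>Z\<close> lie in the span of \<open>d\<^sub>x, d\<^sub>y\<close>.
  With \<open>a, b, c\<close> the parameters \<open>p\<^sup>i\<^sup>j, p\<^sup>j\<^sup>k, p\<^sup>k\<^sup>i\<close> and
  \<open>a', b', c'\<close> the shifted ones, comparing coefficients forces
  \<open>d\<^sub>X = a' d\<^sub>x + (a' + c') d\<^sub>y\<close>, which holds iff \<open>a' c = c' a\<close> and \<open>a' b + c' a + c' b = -1\<close>.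
  With their cyclic images, these equations give \<open>a' D = -a, b' D = -b, c' D = -c\<close> for
  \<open>D = a b + b c + c a\<close>; if \<open>D\<close> were zero, \<open>a, b, c\<close> would vanish, contradicting the second
  equation.\<close>

text \<open>If the dimension is \<open>card B\<close>, extend \<open>B\<close> to a maximal
  independent \<open>C\<close> inside \<open>F\<close>; \<open>C\<close> is finite and of the same
  size, hence equals \<open>B\<close>.\<close>

lemma (in vector_space) dim_eq_card_iff_subset_span:
  assumes "finite F" "B \<subseteq> F" "independent B"
  shows "dim F = card B \<longleftrightarrow> F \<subseteq> span B"
proof
  assume "F \<subseteq> span B"
  then show "dim F = card B"
    using basis_card_eq_dim[OF assms(2) _ assms(3)] by simp
next
  assume dim: "dim F = card B"
  obtain C where C: "B \<subseteq> C" "C \<subseteq> F" "independent C" "F \<subseteq> span C"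
    using maximal_independent_subset_extend[OF assms(2,3)] by blast
  then have "card C = card B"
    using dim basis_card_eq_dim by metis
  then have "B = C"
    using C assms(1) by (metis card_subset_eq finite_subset)
  then show "F \<subseteq> span B"
    using C by simp
qed

interpretation pointwise: vector_space "\<lambda>(c::'a::field) (f::'b \<Rightarrow> 'a) x. c * f x"
  by (rule vector_space_pointwise)

lemma mem_span_pair_pointwise_iff:
  fixes f g h :: "'b \<Rightarrow> 'a::field"
  shows "h \<in> pointwise.span {f, g} \<longleftrightarrow> (\<exists>\<alpha> \<beta>. \<forall>u. h u = \<alpha> * f u + \<beta> * g u)"
  by (auto simp: pointwise.span_insert pointwise.span_singleton fun_eq_iff image_iff
      algebra_simps)

text \<open>The values at \<open>s\<close> and \<open>t\<close> certify independence: no multiple of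
  \<open>g\<close> agrees with \<open>f\<close> at \<open>s\<close>, and \<open>g\<close> is nonzero
  at \<open>t\<close>.\<close>

lemma system_rank_eq_2_iff:
  fixes f g :: "'b \<Rightarrow> 'a::field"
  assumes "finite F" "f \<in> F" "g \<in> F" "f s \<noteq> 0" "g s = 0" "g t \<noteq> 0"
  shows "system_rank F = 2 \<longleftrightarrow> (\<forall>h\<in>F. \<exists>\<alpha> \<beta>. \<forall>u. h u = \<alpha> * f u + \<beta> * g u)"
proof -
  have "f \<noteq> g" "g \<noteq> 0" "f \<notin> pointwise.span {g}"
    using assms(4-6) by (auto simp: pointwise.span_singleton)
  then have "pointwise.independent {f, g}" "card {f, g} = 2"
    by (auto simp: pointwise.independent_insert)
  then show ?thesis
    using pointwise.dim_eq_card_iff_subset_span[OF assms(1), of "{f, g}"] assms(2,3)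
    by (auto simp: system_rank_def subset_iff mem_span_pair_pointwise_iff)
qed

lemma shift_commute: "shift i (shift j n) = shift j (shift i n)"
  by (simp add: ac_simps)

lemma sum_axis: "(\<Sum>m\<in>UNIV. axis i (1::int) $ m) = 1"
  by (simp add: axis_def)

text \<open>Each shift raises the coordinate sum by one, so points reached from \<open>n\<close> by
  different numbers of shifts differ.\<close>

lemma shift_neq [simp]:
  fixes i j k :: "'n::finite"
  shows "shift i n \<noteq> n" "n \<noteq> shift i n"
    "shift i n \<noteq> shift k (shift j n)" "shift k (shift j n) \<noteq> shift i n"
    "n \<noteq> shift k (shift j n)" "shift k (shift j n) \<noteq> n"
proof -
  let ?s = "\<lambda>v::int ^ 'n. \<Sum>m\<in>UNIV. v $ m"
  have s: "?s (shift l v) = ?s v + 1" for l v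
    by (simp add: sum.distrib sum_axis)
  have 1: "?s (shift i n) = ?s n + 1" "?s (shift k (shift j n)) = ?s n + 2"
    unfolding s by simp_all
  show "shift i n \<noteq> n" "n \<noteq> shift i n"
    "shift i n \<noteq> shift k (shift j n)" "shift k (shift j n) \<noteq> shift i n"
    "n \<noteq> shift k (shift j n)" "shift k (shift j n) \<noteq> n"
    by (rule notI, drule arg_cong[where f = ?s], unfold 1, simp)+
qed

lemma corner_form_shift:
  fixes p :: "'n::finite \<Rightarrow> 'n \<Rightarrow> int ^ 'n \<Rightarrow> 'a::real_normed_field"
  assumes "distinct [i, j, k]"
  shows "corner_form p i j k n (shift i n) u =
    2 * (u (shift k (shift i n)) - u (shift j (shift i n))
       + p i j n * (u (shift i n) - u (shift j n)) + p k i n * (u (shift i n) - u (shift k n)))"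
  unfolding corner_form_def cube_sum_def Lagr_def
  apply (rule DERIV_imp_deriv)
  using assms
  \<comment> \<open>These instances put every double shift into the order used in
    \<open>corners\<close>.\<close>
  apply (auto intro!: derivative_eq_intros simp: axis_eq_axis shift_commute[where i=i and j=k]
      shift_commute[where i=i and j=j] shift_commute[where i=j and j=k])
  apply (simp add: algebra_simps)
  done

lemma corner_form_shift_shift:
  fixes p :: "'n::finite \<Rightarrow> 'n \<Rightarrow> int ^ 'n \<Rightarrow> 'a::real_normed_field"
  assumes "distinct [i, j, k]"
  shows "corner_form p i j k n (shift k (shift j n)) u =
    2 * (u (shift k n) - u (shift j n)
       + p i j (shift k n) * (u (shift k (shift i n)) - u (shift k (shift j n)))
       + p k i (shift j n) * (u (shift j (shift i n)) - u (shift k (shift j n))))"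
  unfolding corner_form_def cube_sum_def Lagr_def
  apply (rule DERIV_imp_deriv)
  using assms
  apply (auto intro!: derivative_eq_intros simp: axis_eq_axis shift_commute[where i=i and j=k]
      shift_commute[where i=i and j=j] shift_commute[where i=j and j=k])
  apply (simp add: algebra_simps)
  done

text \<open>Rotation only permutes the summands of \<open>cube_sum\<close>, so the two derivatives
  computed above yield all six.\<close>

lemma corner_form_rotate: "corner_form p i j k = corner_form p j k i"
  by (simp add: corner_form_def cube_sum_def fun_eq_iff ac_simps)

lemma corner_forms_explicit:
  fixes p :: "'n::finite \<Rightarrow> 'n \<Rightarrow> int ^ 'n \<Rightarrow> 'a::real_normed_field" and i j k n
  assumes "distinct [i, j, k]"
  defines "ui \<equiv> shift i n" and "uj \<equiv> shift j n" and "uk \<equiv> shift k n"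
    and "ujk \<equiv> shift k (shift j n)" and "uik \<equiv> shift k (shift i n)" and "uij \<equiv> shift j (shift i n)"
  defines "a \<equiv> p i j n" and "b \<equiv> p j k n" and "c \<equiv> p k i n"
    and "a' \<equiv> p i j uk" and "b' \<equiv> p j k ui" and "c' \<equiv> p k i uj"
  shows "corner_form p i j k n ui u = 2 * (u uik - u uij + a * (u ui - u uj) + c * (u ui - u uk))"
    and "corner_form p i j k n uj u = 2 * (u uij - u ujk + b * (u uj - u uk) + a * (u uj - u ui))"
    and "corner_form p i j k n uk u = 2 * (u ujk - u uik + c * (u uk - u ui) + b * (u uk - u uj))"
    and "corner_form p i j k n ujk u = 2 * (u uk - u uj + a' * (u uik - u ujk) + c' * (u uij - u ujk))"
    and "corner_form p i j k n uik u = 2 * (u ui - u uk + b' * (u uij - u uik) + a' * (u ujk - u uik))"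
    and "corner_form p i j k n uij u = 2 * (u uj - u ui + c' * (u ujk - u uij) + b' * (u uik - u uij))"
  using corner_form_shift[of i j k p n u] corner_form_shift[of j k i p n u]
    corner_form_shift[of k i j p n u] corner_form_shift_shift[of i j k p n u]
    corner_form_shift_shift[of j k i p n u] corner_form_shift_shift[of k i j p n u] assms(1)
  unfolding assms(2-) corner_form_rotate[of p j k i] corner_form_rotate[of p k i j]
  by (auto simp: shift_commute[where i=i and j=k] shift_commute[where i=i and j=j]
      shift_commute[where i=j and j=k] corner_form_rotate[of p i j k])

lemma corners_distinct:
  assumes "distinct [i, j, k]"
  shows "distinct [shift i n, shift j n, shift k n,
      shift k (shift j n), shift k (shift i n), shift j (shift i n)]"
  using assms by (auto simp: axis_eq_axis)

lemma system_rank_corner_form_eq_2_iff: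
  fixes p :: "'n::finite \<Rightarrow> 'n \<Rightarrow> int ^ 'n \<Rightarrow> 'a::real_normed_field"
  assumes ijk: "distinct [i, j, k]"
  shows "system_rank (corner_form p i j k n ` corners i j k n) = 2 \<longleftrightarrow>
    (\<forall>v\<in>corners i j k n. \<exists>\<alpha> \<beta>. \<forall>u. corner_form p i j k n v u =
       \<alpha> * corner_form p i j k n (shift i n) u + \<beta> * corner_form p i j k n (shift j n) u)"
proof -
  let ?F = "corner_form p i j k n ` corners i j k n"
  \<comment> \<open>The field at corner \<open>ik\<close> enters the form of
    \<open>shift i n\<close> but not that of \<open>shift j n\<close>; the field at
    \<open>jk\<close> enters the latter.\<close>
  let ?s = "\<lambda>v. of_bool (v = shift k (shift i n))" and ?t = "\<lambda>v. of_bool (v = shift k (shift j n))"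
  have "finite ?F" "corner_form p i j k n (shift i n) \<in> ?F" "corner_form p i j k n (shift j n) \<in> ?F"
    by (simp_all add: corners_def)
  moreover have "corner_form p i j k n (shift i n) ?s \<noteq> 0" "corner_form p i j k n (shift j n) ?s = 0"
    "corner_form p i j k n (shift j n) ?t \<noteq> 0"
    using corners_distinct[OF ijk] by (auto simp: corner_forms_explicit[OF ijk])
  ultimately show ?thesis
    by (subst system_rank_eq_2_iff) auto
qed

lemma parameter_eqs_if_rank_2:
  fixes p :: "'n::finite \<Rightarrow> 'n \<Rightarrow> int ^ 'n \<Rightarrow> 'a::real_normed_field"
  assumes ijk: "distinct [i, j, k]"
    and rank: "system_rank (corner_form p i j k n ` corners i j k n) = 2"
  defines "a \<equiv> p i j n" and "b \<equiv> p j k n" and "c \<equiv> p k i n"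
    and "a' \<equiv> p i j (shift k n)" and "c' \<equiv> p k i (shift j n)"
  shows "a' * c = c' * a" "a' * b + c' * a + c' * b = -1"
proof -
  define ui uj uk where "ui = shift i n" "uj = shift j n" "uk = shift k n"
  define ujk uik uij where
    "ujk = shift k (shift j n)" "uik = shift k (shift i n)" "uij = shift j (shift i n)"
  note defs = ui_uj_uk_def ujk_uik_uij_def
  have "ujk \<in> corners i j k n"
    by (simp add: corners_def defs)
  then obtain \<alpha> \<beta> where "\<And>u. corner_form p i j k n ujk u =
      \<alpha> * corner_form p i j k n ui u + \<beta> * corner_form p i j k n uj u"
    using rank system_rank_corner_form_eq_2_iff[OF ijk, of p n] unfolding defs by blast
  then have "2 * (u uk - u uj + a' * (u uik - u ujk) + c' * (u uij - u ujk)) =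
      2 * (\<alpha> * (u uik - u uij + a * (u ui - u uj) + c * (u ui - u uk)) +
      \<beta> * (u uij - u ujk + b * (u uj - u uk) + a * (u uj - u ui)))" for u
    unfolding defs corner_forms_explicit[OF ijk] a_def b_def c_def a'_def c'_def
    by (simp add: algebra_simps)
  then have E: "u uk - u uj + a' * (u uik - u ujk) + c' * (u uij - u ujk) =
      \<alpha> * (u uik - u uij + a * (u ui - u uj) + c * (u ui - u uk)) +
      \<beta> * (u uij - u ujk + b * (u uj - u uk) + a * (u uj - u ui))" for u
    by (metis mult_cancel_left zero_neq_numeral)
  have dist: "distinct [ui, uj, uk, ujk, uik, uij]"
    using corners_distinct[OF ijk] unfolding defs .
  \<comment> \<open>Indicator fields read off coefficients. In every form the coefficients over the
    single shifts, and those over the double shifts, sum to zero, so \<open>uk\<close> and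
    \<open>ujk\<close> would add nothing.\<close>
  have coeffs: "a' = \<alpha>" "c' = \<beta> - \<alpha>" "0 = \<alpha> * (a + c) - \<beta> * a"
    "-1 = - \<alpha> * a + \<beta> * (a + b)"
    using E[of "\<lambda>v. of_bool (v = uik)"] E[of "\<lambda>v. of_bool (v = uij)"]
      E[of "\<lambda>v. of_bool (v = ui)"] E[of "\<lambda>v. of_bool (v = uj)"] dist
    by (auto simp: algebra_simps)
  show "a' * c = c' * a"
    using coeffs(3) by (simp add: coeffs(1,2) algebra_simps)
  show "a' * b + c' * a + c' * b = -1"
    using coeffs(4) by (simp add: coeffs(1,2) algebra_simps)
qed

lemma star_triangle_if_parameter_eqs:
  fixes a b c a' b' c' :: "'a::field"
  assumes "a' * c = c' * a" "b' * a = a' * b" "c' * b = b' * c"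
    and "a' * b + c' * a + c' * b = -1"
  defines "D \<equiv> a * b + b * c + c * a"
  shows "D \<noteq> 0" "a' = - (a / D)"
proof -
  \<comment> \<open>Multiply the last equation by \<open>a\<close>, \<open>b\<close>,
    \<open>c\<close> in turn and exchange primes by the first three, which say that the triples are
    proportional.\<close>
  have D: "a' * D = - a" "b' * D = - b" "c' * D = - c"
    using assms by algebra+
  show "D \<noteq> 0"
    using assms(4) D by auto
  then show "a' = - (a / D)"
    using D(1) by (simp add: field_simps)
qed

lemma rank_2_if_parameter_eqs:
  fixes p :: "'n::finite \<Rightarrow> 'n \<Rightarrow> int ^ 'n \<Rightarrow> 'a::real_normed_field" and i j k n
  assumes ijk: "distinct [i, j, k]"
  defines "a \<equiv> p i j n" and "b \<equiv> p j k n" and "c \<equiv> p k i n"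
    and "a' \<equiv> p i j (shift k n)" and "b' \<equiv> p j k (shift i n)" and "c' \<equiv> p k i (shift j n)"
  assumes "a' * c = c' * a" "b' * a = a' * b" "c' * b = b' * c"
    and "a' * b + c' * a + c' * b = -1"
  shows "system_rank (corner_form p i j k n ` corners i j k n) = 2"
proof -
  note eqs = assms(8-11)
  let ?d = "corner_form p i j k n"
  note explicit = corner_forms_explicit[OF ijk, of p n,
      folded a_def b_def c_def a'_def b'_def c'_def]
  have "?d (shift k n) u = - 1 * ?d (shift i n) u + - 1 * ?d (shift j n) u" for u
    unfolding explicit by algebra
  moreover have "?d (shift k (shift j n)) u =
      a' * ?d (shift i n) u + (a' + c') * ?d (shift j n) u" for u
    unfolding explicit using eqs by algebra
  \<comment> \<open>This and the next combination are cyclic images of the previous one, with the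
    form of \<open>shift k n\<close> eliminated. The inhomogeneous equation is cyclically invariant
    modulo the other three.\<close>
  moreover have "?d (shift k (shift i n)) u =
      - (a' + b') * ?d (shift i n) u + - a' * ?d (shift j n) u" for u
    unfolding explicit using eqs by algebra
  moreover have "?d (shift j (shift i n)) u =
      b' * ?d (shift i n) u + - c' * ?d (shift j n) u" for u
    unfolding explicit using eqs by algebra
  moreover have "?d (shift i n) u = 1 * ?d (shift i n) u + 0 * ?d (shift j n) u"
    "?d (shift j n) u = 0 * ?d (shift i n) u + 1 * ?d (shift j n) u" for u
    by simp_all
  ultimately show ?thesis
    unfolding system_rank_corner_form_eq_2_iff[OF ijk] unfolding corners_def by blast
qed

theorem theorem11:
  fixes p :: "'n::finite \<Rightarrow> 'n \<Rightarrow> int ^ 'n \<Rightarrow> 'a::real_normed_field"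
  assumes "CARD('n) \<ge> 3"
    and "\<And>i j n. i \<noteq> j \<Longrightarrow> p i j n = - p j i n"
  shows "consistent p \<longleftrightarrow> star_triangle p"
proof
  assume consistent: "consistent p"
  have "p i j n * p j k n + p j k n * p k i n + p k i n * p i j n \<noteq> 0 \<and>
      p i j (shift k n) =
        - (p i j n / (p i j n * p j k n + p j k n * p k i n + p k i n * p i j n))"
    if "distinct [i, j, k]" for i j k n
  proof -
    have eqs: "p i j (shift k n) * p k i n = p k i (shift j n) * p i j n \<and>
        p i j (shift k n) * p j k n + p k i (shift j n) * p i j n + p k i (shift j n) * p j k n = -1"
      if "distinct [i, j, k]" for i j k
      using parameter_eqs_if_rank_2[OF that, of p n] that consistent unfolding consistent_def by blast
    show ?thesis
      \<comment> \<open>Each rotation of the cube contributes one of the three proportionality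
        equations.\<close>
      using star_triangle_if_parameter_eqs[of "p i j (shift k n)" "p k i n" "p k i (shift j n)" "p i j n"
          "p j k (shift i n)" "p j k n"]
        eqs[of i j k] eqs[of j k i] eqs[of k i j] that by auto
  qed
  then show "star_triangle p"
    unfolding star_triangle_def by blast
next
  assume star: "star_triangle p"
  have "system_rank (corner_form p i j k n ` corners i j k n) = 2"
    if ijk: "distinct [i, j, k]" for i j k n
  proof -
    define D where "D = p i j n * p j k n + p j k n * p k i n + p k i n * p i j n"
    \<comment> \<open>The denominator is cyclically invariant, so all three relations share
      it.\<close>
    have rotate: "p j k n * p k i n + p k i n * p i j n + p i j n * p j k n = D"
      "p k i n * p i j n + p i j n * p j k n + p j k n * p k i n = D"
      by (simp_all add: D_def)
    have "distinct [j, k, i]" "distinct [k, i, j]"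
      using ijk by auto
    then have "D \<noteq> 0" and p: "p i j (shift k n) = - (p i j n / D)"
      "p j k (shift i n) = - (p j k n / D)" "p k i (shift j n) = - (p k i n / D)"
      using star ijk unfolding star_triangle_def by (metis D_def rotate)+
    \<comment> \<open>With the inverse as a variable, the goals become polynomial
      identities.\<close>
    define t where "t = 1 / D"
    have t: "t * (p i j n * p j k n + p j k n * p k i n + p k i n * p i j n) = 1"
      using \<open>D \<noteq> 0\<close> by (simp add: t_def flip: D_def)
    have "p i j (shift k n) = - t * p i j n" "p j k (shift i n) = - t * p j k n"
      "p k i (shift j n) = - t * p k i n"
      using p by (simp_all add: t_def)
    with t show ?thesis
      by (intro rank_2_if_parameter_eqs[OF ijk]) algebra+
  qed
  then show "consistent p"
    unfolding consistent_def by blast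
qed

end
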